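(* Let $k \geq 2$ be an integer, and suppose there are $k$ potential input values. Let $G$ be a network whose largest component has $h$ processors, where $h$ satisfies $$\frac{|G|-h}{k} \in \mathbf{Z} \quad\text{and}\quad h > \left( \frac{k-2}{2(k-1)} \right) |G|.$$ Then there exists a successful majority agreement protocol for $G$.
   Context: A network $G$ is a finite nonempty (possibly disconnected) undirected graph whose vertices are called processors; $|G|$ is the number of processors, and the size of a component (connected component) is its number of processors. Fix a set $V$ of $k$ (distinct) potential values. All processors know the whole network and the protocol. Each processor $i$ is given an input value $v_i \in V$ and may communicate without limit (and without faults), but only with the processors in its own component, after which it outputs a value in $V$. Thus a (deterministic) protocol amounts to choosing, for each processor $i$, a function giving the output of $i$ in $V$ in terms of the inputs of all the processors in the component of $i$ (and of no other inputs); these functions may be arbitrary and may differ between processors. A protocol is a successful majority agreement protocol if for every assignment of inputs $(v_i)$ there is a value $v \in V$ such that: (i) strictly more than $|G|/2$ of the processors output $v$; and (ii) if all processors have the same input $v_c$, then $v = v_c$. *)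

theory Defs
  imports "Graph_Theory.Digraph_Component" "HOL-Library.FuncSet" Complex_Main
begin

definition network :: "('p, 'e) pre_digraph \<Rightarrow> bool" where
  "network G \<longleftrightarrow> graph G \<and> verts G \<noteq> {}"

text \<open>
  Undirected graphs are symmetric digraphs here, so strongly connected components are exactly
  the connected components.
\<close>

abbreviation component_of :: "('p, 'e) pre_digraph \<Rightarrow> 'p \<Rightarrow> 'p set" where
  "component_of G i \<equiv> pre_digraph.scc_of G i"

abbreviation components :: "('p, 'e) pre_digraph \<Rightarrow> 'p set set" where
  "components G \<equiv> pre_digraph.sccs_verts G"

definition largest_component_size :: "('p, 'e) pre_digraph \<Rightarrow> nat" where
  "largest_component_size G = Max (card ` components G)"

text \<open>
  Locality of communication is built in: the domain of the output function of processor \<open>i\<close>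
  consists of the input assignments to the component of \<open>i\<close> only.
\<close>

definition protocol ::
    "('p, 'e) pre_digraph \<Rightarrow> 'v set \<Rightarrow> ('p \<Rightarrow> ('p \<Rightarrow> 'v) \<Rightarrow> 'v) \<Rightarrow> bool" where
  "protocol G V P \<longleftrightarrow> (\<forall>i \<in> verts G. P i \<in> (component_of G i \<rightarrow>\<^sub>E V) \<rightarrow> V)"

definition protocol_output ::
    "('p, 'e) pre_digraph \<Rightarrow> ('p \<Rightarrow> ('p \<Rightarrow> 'v) \<Rightarrow> 'v) \<Rightarrow> ('p \<Rightarrow> 'v) \<Rightarrow> 'p \<Rightarrow> 'v" where
  "protocol_output G P x i = P i (restrict x (component_of G i))"

definition successful_majority_agreement_protocol ::
    "('p, 'e) pre_digraph \<Rightarrow> 'v set \<Rightarrow> ('p \<Rightarrow> ('p \<Rightarrow> 'v) \<Rightarrow> 'v) \<Rightarrow> bool" where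
  "successful_majority_agreement_protocol G V P \<longleftrightarrow>
     protocol G V P \<and>
     (\<forall>x \<in> verts G \<rightarrow>\<^sub>E V. \<exists>v \<in> V.
        real (card {i \<in> verts G. protocol_output G P x i = v}) > real (card (verts G)) / 2 \<and>
        (\<forall>c \<in> V. (\<forall>i \<in> verts G. x i = c) \<longrightarrow> v = c))"

end

theory Submission
  imports Defs
begin

text \<open>
  A leader in a largest component \<open>C\<close> dictates: every processor in \<open>C\<close> outputs the leader's input.
  The \<open>n - h = k * m\<close> processors outside \<open>C\<close> ignore their inputs and output each of the \<open>k\<close> values
  exactly \<open>m\<close> times, so whatever the leader's input is, it is output \<open>h + (n - h) / k\<close> times; the
  bound on \<open>h\<close> says exactly that this exceeds \<open>n / 2\<close>.
\<close>

text \<open>Equal cardinalities give a bijection from \<open>A\<close> onto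
  \<open>V \<times> {..<m}\<close>; following it by the first projection makes every fibre a copy of
  \<open>{..<m}\<close>.\<close>

lemma ex_balanced_map:
  assumes "finite A" "finite V" "card A = card V * m"
  obtains f where "f \<in> A \<rightarrow> V" "\<And>v. v \<in> V \<Longrightarrow> card {a \<in> A. f a = v} = m"
proof -
  have "card A = card (V \<times> {..<m})"
    using assms by (simp add: card_cartesian_product)
  then obtain g where g: "bij_betw g A (V \<times> {..<m})"
    using assms by (meson finite_SigmaI finite_lessThan finite_same_card_bij)
  have "card {a \<in> A. fst (g a) = v} = m" if "v \<in> V" for v
  proof -
    have "g ` {a \<in> A. fst (g a) = v} = {p \<in> g ` A. fst p = v}"
      by auto
    also have "\<dots> = {v} \<times> {..<m}"
      using that bij_betw_imp_surj_on[OF g] by auto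
    finally have "card (g ` {a \<in> A. fst (g a) = v}) = m"
      by (simp add: card_cartesian_product)
    moreover have "inj_on g {a \<in> A. fst (g a) = v}"
      using bij_betw_imp_inj_on[OF g] by (rule inj_on_subset) auto
    ultimately show ?thesis
      by (simp add: card_image)
  qed
  moreover have "fst \<circ> g \<in> A \<rightarrow> V"
    using bij_betwE[OF g] by fastforce
  ultimately show thesis
    by (intro that[of "fst \<circ> g"]) auto
qed

lemma ex_largest_component:
  assumes "network G"
  obtains C where "C \<in> components G" "card C = largest_component_size G"
proof -
  interpret graph G using assms by (simp add: network_def)
  obtain u where "u \<in> verts G" using assms by (auto simp: network_def)
  then have "components G \<noteq> {}"
    using scc_of_in_sccs_verts by blast
  then have "Max (card ` components G) \<in> card ` components G"
    by (intro Max_in) (auto simp: finite_sccs_verts)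
  then show thesis
    using that by (auto simp: largest_component_size_def)
qed

theorem corollary2:
  fixes G :: "('p, 'e) pre_digraph" and V :: "'v set" and k h :: nat
  assumes "k \<ge> 2"
    and "finite V" and "card V = k"
    and "network G"
    and "largest_component_size G = h"
    and "(real (card (verts G)) - real h) / real k \<in> \<int>"
    and "real h > ((real k - 2) / (2 * (real k - 1))) * real (card (verts G))"
  shows "\<exists>P. successful_majority_agreement_protocol G V P"
proof -
  interpret graph G using assms(4) by (simp add: network_def)
  obtain C where C: "C \<in> components G" and cardC: "card C = h"
    using ex_largest_component assms(4,5) by blast
  have CG: "C \<subseteq> verts G" and "C \<noteq> {}"
    using C sccs_verts_subsets in_sccs_verts_conv_reachable by blast+
  then obtain l where l: "l \<in> C" by blast
  \<comment> \<open>Hence every processor in \<open>C\<close> sees the inputs of all of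
    \<open>C\<close>, in particular that of the leader \<open>l\<close>.\<close>
  have comp: "component_of G i = C" if "i \<in> C" for i
    using C that unfolding sccs_verts_conv_scc_of by (auto dest: scc_of_eq)
  let ?n = "card (verts G)"
  have "h \<le> ?n"
    using CG cardC by (auto intro: card_mono)
  obtain z where z: "(real ?n - real h) / real k = of_int z"
    using assms(6) by (auto elim: Ints_cases)
  \<comment> \<open>Nonnegativity makes the integer quotient a natural number, the \<open>m\<close>
    needed for the balanced map.\<close>
  then have "0 \<le> z"
    using \<open>h \<le> ?n\<close> by (smt (verit) divide_nonneg_nonneg of_int_0_le_iff of_nat_0_le_iff of_nat_mono)
  define m where "m = nat z"
  have m: "real ?n - real h = real k * real m"
    using z \<open>0 \<le> z\<close> assms(1) by (simp add: m_def field_simps)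
  have "real ?n = real (h + k * m)" using m by simp
  then have "?n = h + k * m" by (simp only: of_nat_eq_iff)
  then have "card (verts G - C) = card V * m"
    using CG cardC assms(3) by (simp add: card_Diff_subset finite_subset)
  then obtain f where f: "f \<in> verts G - C \<rightarrow> V"
    "\<And>v. v \<in> V \<Longrightarrow> card {i \<in> verts G - C. f i = v} = m"
    using ex_balanced_map[of "verts G - C" V m] assms(2) by auto
  have majority: "real (h + m) > real ?n / 2"
  proof -
    \<comment> \<open>Denominators clear because \<open>k - 1\<close> is positive. Adding
      \<open>2 * ?n\<close> and substituting \<open>?n = h + k * m\<close> turns the right-hand side
      into \<open>2 * k * (h + m)\<close>; then the positive factor \<open>k\<close>
      cancels.\<close>
    have "(real k - 2) * real ?n < 2 * (real k - 1) * real h"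
      using assms(1,7) by (simp add: field_simps)
    moreover have "real k * real ?n = real k * (real h + real k * real m)"
      using m by simp
    ultimately have "real k * real ?n < real k * (2 * (real h + real m))"
      using m by (simp add: algebra_simps)
    then show ?thesis
      using assms(1) by (simp add: mult_less_cancel_left)
  qed
  define P where "P i y = (if i \<in> C then y l else f i)" for i and y :: "'p \<Rightarrow> 'v"
  have "protocol G V P"
    using f(1) comp l by (simp add: protocol_def P_def Pi_iff PiE_iff)
  moreover have "\<exists>v \<in> V. real (card {i \<in> verts G. protocol_output G P x i = v}) > real ?n / 2 \<and>
      (\<forall>c \<in> V. (\<forall>i \<in> verts G. x i = c) \<longrightarrow> v = c)" if x: "x \<in> verts G \<rightarrow>\<^sub>E V" for x
  \<comment> \<open>The witness is the leader's input \<open>x l\<close>, which equals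
    \<open>c\<close> when all inputs are \<open>c\<close>.\<close>
  proof (intro bexI conjI ballI impI)
    show "x l \<in> V" using x l CG by auto
    \<comment> \<open>For \<open>i\<close> in \<open>C\<close>, restricting \<open>x\<close> to the
      component of \<open>i\<close> keeps its value at \<open>l\<close>, so all of \<open>C\<close>
      outputs \<open>x l\<close>.\<close>
    have "{i \<in> verts G. protocol_output G P x i = x l} = C \<union> {i \<in> verts G - C. f i = x l}"
      using CG l comp by (auto simp: protocol_output_def P_def)
    also have "card \<dots> = h + m"
      using f(2)[OF \<open>x l \<in> V\<close>] CG cardC
      by (subst card_Un_disjoint) (auto intro: finite_subset)
    finally show "real (card {i \<in> verts G. protocol_output G P x i = x l}) > real ?n / 2"
      using majority by simp
    show "x l = c" if "\<forall>i \<in> verts G. x i = c" for c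
      using that l CG by auto
  qed
  ultimately show ?thesis
    by (auto simp: successful_majority_agreement_protocol_def)
qed

end
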